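(* Let $\mathcal{A}$ be an operator ideal, let $\lambda\geq 1$, and let $X$ be a real Banach space with the isometric lifting property. Then $X$ has the $\mathcal{A}$-$\lambda$-BAP if $X$ has the Lip-$\mathcal{A}$-$\lambda$-BAP.
   Context: All Banach spaces are real. For Banach spaces $X,Y$, $\mathcal{L}(X,Y)$ is the space of bounded linear operators, and $\mathrm{Lip}_0(X,Y)$ is the Banach space of Lipschitz maps $f:X\to Y$ with $f(0)=0$, with norm $\|f\|_{\mathrm{Lip}}=\sup_{x\neq y}\|f(x)-f(y)\|/\|x-y\|$; $\mathrm{Lip}_0(X)=\mathrm{Lip}_0(X,\mathbb{R})$. For $x\in X$ let $\delta_x\in \mathrm{Lip}_0(X)^*$, $\delta_x(f)=f(x)$. The Lipschitz-free space is $\mathfrak{F}(X)=\overline{\mathrm{span}}\{\delta_x: x\in X\}\subseteq \mathrm{Lip}_0(X)^*$, and $\delta_X:X\to\mathfrak{F}(X)$, $\delta_X(x)=\delta_x$. For each $f\in\mathrm{Lip}_0(X,Y)$ there is a unique $L_f\in\mathcal{L}(\mathfrak{F}(X),Y)$ with $L_f\delta_X=f$, and $\|L_f\|=\|f\|_{\mathrm{Lip}}$. The map $\beta_X:\mathfrak{F}(X)\to X$ is the bounded linear quotient map determined by $x^*(\beta_X(\mu))=\langle x^*,\mu\rangle$ for all $x^*\in X^*\subseteq\mathrm{Lip}_0(X)$; so $\beta_X(\delta_x)=x$. $X$ has the isometric lifting property if there exists $U\in\mathcal{L}(X,\mathfrak{F}(X))$ with $\|U\|=1$ and $\beta_XU=\mathrm{Id}_X$.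 Operator ideals are (linear) operator ideals in the usual sense. For an operator ideal $\mathcal{A}$ and $\lambda\ge 1$: $\mathcal{A}^\lambda(X,Y)=\{T\in\mathcal{A}(X,Y):\|T\|\le\lambda\}$; $\mathrm{Lip}_{\mathcal{A}}(X,Y)=\{f\in\mathrm{Lip}_0(X,Y): L_f\in\mathcal{A}(\mathfrak{F}(X),Y)\}$; $\mathrm{Lip}_{\mathcal{A}}^\lambda(X,Y)=\{f\in\mathrm{Lip}_{\mathcal{A}}(X,Y):\|f\|_{\mathrm{Lip}}\le\lambda\}$. $\tau_c$ denotes the compact-open topology (uniform convergence on compact subsets of the domain). $X$ has the $\mathcal{A}$-$\lambda$-BAP if $\mathrm{Id}_X\in\overline{\mathcal{A}^\lambda(X,X)}^{\tau_c}$, and the Lip-$\mathcal{A}$-$\lambda$-BAP if $\mathrm{Id}_X\in\overline{\mathrm{Lip}_{\mathcal{A}}^\lambda(X,X)}^{\tau_c}$. *)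

theory Defs
  imports "HOL-Analysis.Analysis"
begin

section \<open>The space of Lipschitz maps vanishing at the origin\<close>

typedef (overloaded) ('a, 'b) lip0 =
  "{f :: 'a::real_normed_vector \<Rightarrow> 'b::real_normed_vector. f 0 = 0 \<and> (\<exists>C. C-lipschitz_on UNIV f)}"
  morphisms lip0_apply Lip0
  by (rule exI[of _ "\<lambda>_. 0"]) (auto intro!: exI[of _ 0] lipschitz_onI)

setup_lifting type_definition_lip0

lemma lip0_eqI: "(\<And>x. lip0_apply f x = lip0_apply g x) \<Longrightarrow> f = g"
  by transfer auto

lemma lip0_zero [simp]: "lip0_apply f 0 = 0"
  by transfer auto

definition lip_const :: "('a::real_normed_vector \<Rightarrow> 'b::real_normed_vector) \<Rightarrow> real" where
  \<comment> \<open>The diagonal contributes \<open>0 / 0 = 0\<close>, so this is the supremum over \<open>x \<noteq> y\<close>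
      (and \<open>0\<close> if there are no such pairs).\<close>
  "lip_const f = (SUP (x, y). norm (f x - f y) / norm (x - y))"

lemma bdd_above_lip:
  assumes "C-lipschitz_on UNIV f"
  shows "bdd_above (range (\<lambda>(x, y). norm (f x - f y) / norm (x - y)))"
proof (rule bdd_aboveI2[of _ _ C], clarsimp)
  fix x y
  have "norm (f x - f y) \<le> C * norm (x - y)" "0 \<le> C"
    using lipschitz_onD[OF assms, of x y] lipschitz_on_nonneg[OF assms] by (auto simp: dist_norm)
  then show "norm (f x - f y) / norm (x - y) \<le> C"
    by (cases "x = y") (auto simp: divide_simps)
qed

lemma lip_const_bound:
  assumes "C-lipschitz_on UNIV f"
  shows "norm (f x - f y) \<le> lip_const f * norm (x - y)"
proof (cases "x = y")
  case False
  have "norm (f x - f y) / norm (x - y) \<le> lip_const f"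
    unfolding lip_const_def
    by (rule cSUP_upper2[OF bdd_above_lip[OF assms], of "(x, y)"]) auto
  then show ?thesis using False by (simp add: divide_simps)
qed auto

lemma lip_const_le:
  assumes "0 \<le> C" "\<And>x y. norm (f x - f y) \<le> C * norm (x - y)"
  shows "lip_const f \<le> C"
  unfolding lip_const_def
proof (rule cSUP_least, simp, clarsimp)
  fix x y
  show "norm (f x - f y) / norm (x - y) \<le> C"
    using assms(2)[of x y] assms(1) by (cases "x = y") (auto simp: divide_simps)
qed

lemma lip_const_nonneg: "C-lipschitz_on UNIV f \<Longrightarrow> 0 \<le> lip_const f"
  unfolding lip_const_def
  by (rule cSUP_upper2[OF bdd_above_lip, of _ _ "(0, 0)"]) auto

lemma ex_lipschitzI:
  assumes "0 \<le> C" "\<And>x y. norm (f x - f y) \<le> C * norm (x - y)"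
  shows "\<exists>C. C-lipschitz_on UNIV f"
  using assms by (auto intro!: exI[of _ C] lipschitz_onI simp: dist_norm)

instantiation lip0 :: (real_normed_vector, real_normed_vector) real_normed_vector
begin

lift_definition norm_lip0 :: "('a, 'b) lip0 \<Rightarrow> real" is lip_const .

lift_definition zero_lip0 :: "('a, 'b) lip0" is "\<lambda>_. 0"
  by (auto intro!: ex_lipschitzI[of 0])

lift_definition plus_lip0 :: "('a, 'b) lip0 \<Rightarrow> ('a, 'b) lip0 \<Rightarrow> ('a, 'b) lip0"
  is "\<lambda>f g x. f x + g x"
  by (auto intro: lipschitz_on_add)

lift_definition minus_lip0 :: "('a, 'b) lip0 \<Rightarrow> ('a, 'b) lip0 \<Rightarrow> ('a, 'b) lip0"
  is "\<lambda>f g x. f x - g x"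
  by (auto intro: lipschitz_on_diff)

lift_definition uminus_lip0 :: "('a, 'b) lip0 \<Rightarrow> ('a, 'b) lip0" is "\<lambda>f x. - f x"
  by (auto intro: lipschitz_on_minus)

lift_definition scaleR_lip0 :: "real \<Rightarrow> ('a, 'b) lip0 \<Rightarrow> ('a, 'b) lip0" is "\<lambda>r f x. r *\<^sub>R f x"
  by (auto intro: lipschitz_on_cmult)

definition dist_lip0 :: "('a, 'b) lip0 \<Rightarrow> ('a, 'b) lip0 \<Rightarrow> real"
  where "dist_lip0 f g = norm (f - g)"

definition sgn_lip0 :: "('a, 'b) lip0 \<Rightarrow> ('a, 'b) lip0"
  where "sgn_lip0 f = inverse (norm f) *\<^sub>R f"

definition uniformity_lip0 :: "(('a, 'b) lip0 \<times> ('a, 'b) lip0) filter"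
  where "uniformity_lip0 = (INF e\<in>{0 <..}. principal {(f, g). dist f g < e})"

definition open_lip0 :: "('a, 'b) lip0 set \<Rightarrow> bool"
  where "open_lip0 S = (\<forall>f\<in>S. \<forall>\<^sub>F (f', g) in uniformity. f' = f \<longrightarrow> g \<in> S)"

lemma lip0_bound: "norm (lip0_apply f x - lip0_apply f y) \<le> norm f * norm (x - y)"
  for f :: "('a, 'b) lip0"
  by transfer (auto intro: lip_const_bound)

lemma norm_lip0_le:
  fixes f :: "('a, 'b) lip0"
  assumes "0 \<le> C" "\<And>x y. norm (lip0_apply f x - lip0_apply f y) \<le> C * norm (x - y)"
  shows "norm f \<le> C"
  using assms by transfer (auto intro: lip_const_le)

lemma norm_lip0_nonneg: "0 \<le> norm f" for f :: "('a, 'b) lip0"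
  by transfer (auto intro: lip_const_nonneg)

lemma norm_lip0_scaleR_le: "norm (r *\<^sub>R f) \<le> \<bar>r\<bar> * norm f" for f :: "('a, 'b) lip0"
proof (rule norm_lip0_le)
  fix x y
  show "norm (lip0_apply (r *\<^sub>R f) x - lip0_apply (r *\<^sub>R f) y) \<le> \<bar>r\<bar> * norm f * norm (x - y)"
    using mult_left_mono[OF lip0_bound[of f x y], of "\<bar>r\<bar>"]
    by (simp add: scaleR_lip0.rep_eq mult.assoc flip: scaleR_right_diff_distrib)
qed (simp add: norm_lip0_nonneg)

instance
proof
  fix f g h :: "('a, 'b) lip0" and r s :: real
  show "f + g + h = f + (g + h)" by transfer (simp add: add.assoc)
  show "f + g = g + f" by transfer (simp add: add.commute)
  show "0 + f = f" by transfer simp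
  show "- f + f = 0" by transfer simp
  show "f - g = f + - g" by transfer simp
  show "r *\<^sub>R (f + g) = r *\<^sub>R f + r *\<^sub>R g" by transfer (simp add: scaleR_right_distrib)
  show "(r + s) *\<^sub>R f = r *\<^sub>R f + s *\<^sub>R f" by transfer (simp add: scaleR_left_distrib)
  show "r *\<^sub>R s *\<^sub>R f = (r * s) *\<^sub>R f" by transfer simp
  show "1 *\<^sub>R f = f" by transfer simp
  show "dist f g = norm (f - g)" by (simp add: dist_lip0_def)
  show "sgn f = inverse (norm f) *\<^sub>R f" by (simp add: sgn_lip0_def)
  show "(uniformity :: (('a, 'b) lip0 \<times> ('a, 'b) lip0) filter)
      = (INF e\<in>{0 <..}. principal {(f, g). dist f g < e})"
    by (simp add: uniformity_lip0_def)
  show "open U = (\<forall>f\<in>U. \<forall>\<^sub>F (f', g) in uniformity. f' = f \<longrightarrow> g \<in> U)" for U :: "('a, 'b) lip0 set"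
    by (simp add: open_lip0_def)
  show "norm f = 0 \<longleftrightarrow> f = 0"
  proof
    assume "norm f = 0"
    then show "f = 0"
      using lip0_bound[of f _ 0] by (intro lip0_eqI) (simp add: zero_lip0.rep_eq)
  next
    assume "f = 0"
    then have "norm f \<le> 0"
      by (intro norm_lip0_le) (auto simp: zero_lip0.rep_eq)
    then show "norm f = 0" using norm_lip0_nonneg[of f] by simp
  qed
  show "norm (f + g) \<le> norm f + norm g"
  proof (rule norm_lip0_le)
    fix x y
    have "norm (lip0_apply (f + g) x - lip0_apply (f + g) y)
        = norm ((lip0_apply f x - lip0_apply f y) + (lip0_apply g x - lip0_apply g y))"
      by (simp add: plus_lip0.rep_eq algebra_simps)
    also have "\<dots> \<le> norm (lip0_apply f x - lip0_apply f y) + norm (lip0_apply g x - lip0_apply g y)"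
      by (rule norm_triangle_ineq)
    also have "\<dots> \<le> (norm f + norm g) * norm (x - y)"
      using lip0_bound[of f x y] lip0_bound[of g x y] by (simp add: distrib_right)
    finally show "norm (lip0_apply (f + g) x - lip0_apply (f + g) y) \<le> (norm f + norm g) * norm (x - y)" .
  qed (simp add: norm_lip0_nonneg)
  show "norm (r *\<^sub>R f) = \<bar>r\<bar> * norm f"
  proof (cases "r = 0")
    case True
    then have "norm (r *\<^sub>R f) \<le> 0"
      by (intro norm_lip0_le) (auto simp: scaleR_lip0.rep_eq)
    then show ?thesis using True norm_lip0_nonneg[of "r *\<^sub>R f"] by simp
  next
    case False
    have "inverse r *\<^sub>R r *\<^sub>R f = f" using False by transfer simp
    then have "norm f \<le> \<bar>inverse r\<bar> * norm (r *\<^sub>R f)"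
      using norm_lip0_scaleR_le[of "inverse r" "r *\<^sub>R f"] by simp
    then have "\<bar>r\<bar> * norm f \<le> norm (r *\<^sub>R f)"
      using False by (simp add: divide_simps mult.commute)
    then show ?thesis using norm_lip0_scaleR_le[of r f] by simp
  qed
qed

end

lift_definition lip0_of_blinfun ::
    "('a::real_normed_vector \<Rightarrow>\<^sub>L 'b::real_normed_vector) \<Rightarrow> ('a, 'b) lip0" is "\<lambda>T. T"
proof safe
  fix T :: "'a \<Rightarrow> 'b"
  assume T: "bounded_linear T"
  show "T 0 = 0" using T by (simp add: linear_simps)
  show "\<exists>C. C-lipschitz_on UNIV T"
    using onorm[OF T] onorm_pos_le[OF T]
    by (intro ex_lipschitzI[of "onorm T"]) (simp_all flip: linear_simps(2)[OF T])
qed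

section \<open>The Lipschitz-free space\<close>

lift_definition dirac :: "'a::real_normed_vector \<Rightarrow> (('a, real) lip0 \<Rightarrow>\<^sub>L real)"
  is "\<lambda>x f. lip0_apply f x"
proof
  fix x :: 'a and f g :: "('a, real) lip0" and r :: real
  show "lip0_apply (f + g) x = lip0_apply f x + lip0_apply g x" by (simp add: plus_lip0.rep_eq)
  show "lip0_apply (r *\<^sub>R f) x = r *\<^sub>R lip0_apply f x" by (simp add: scaleR_lip0.rep_eq)
  show "\<exists>K. \<forall>f :: ('a, real) lip0. norm (lip0_apply f x) \<le> norm f * K"
    using lip0_bound[where 'b=real, of _ x 0] by (intro exI[of _ "norm x"] allI) simp
qed

typedef (overloaded) 'a lipfree =
  "closure (span (range (dirac :: 'a::real_normed_vector \<Rightarrow> ('a, real) lip0 \<Rightarrow>\<^sub>L real)))"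
  morphisms lipfree_dual Lipfree
  using closure_subset span_zero by blast

setup_lifting type_definition_lipfree

lemma subspace_lipfree:
  "subspace (closure (span (range (dirac :: 'a::real_normed_vector \<Rightarrow> ('a, real) lip0 \<Rightarrow>\<^sub>L real))))"
  unfolding subspace_def
proof (intro conjI ballI allI)
  let ?S = "span (range (dirac :: 'a \<Rightarrow> ('a, real) lip0 \<Rightarrow>\<^sub>L real))"
  show "0 \<in> closure ?S"
    using closure_subset span_zero by blast
  fix \<mu> assume \<mu>: "\<mu> \<in> closure ?S"
  then obtain s where s: "\<And>n. s n \<in> ?S" "s \<longlonglongrightarrow> \<mu>"
    by (auto simp: closure_sequential)
  show "r *\<^sub>R \<mu> \<in> closure ?S" for r
    unfolding closure_sequential using s
    by (intro exI[of _ "\<lambda>n. r *\<^sub>R s n"]) (auto intro: span_scale tendsto_intros)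
  fix \<nu> assume "\<nu> \<in> closure ?S"
  then obtain t where t: "\<And>n. t n \<in> ?S" "t \<longlonglongrightarrow> \<nu>"
    by (auto simp: closure_sequential)
  show "\<mu> + \<nu> \<in> closure ?S"
    unfolding closure_sequential using s t
    by (intro exI[of _ "\<lambda>n. s n + t n"]) (auto intro: span_add tendsto_intros)
qed

instantiation lipfree :: (real_normed_vector) real_normed_vector
begin

lift_definition norm_lipfree :: "'a lipfree \<Rightarrow> real" is norm .

lift_definition zero_lipfree :: "'a lipfree" is 0
  by (rule subspace_0[OF subspace_lipfree])

lift_definition plus_lipfree :: "'a lipfree \<Rightarrow> 'a lipfree \<Rightarrow> 'a lipfree" is "(+)"
  by (rule subspace_add[OF subspace_lipfree])

lift_definition minus_lipfree :: "'a lipfree \<Rightarrow> 'a lipfree \<Rightarrow> 'a lipfree" is "(-)"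
  by (rule subspace_diff[OF subspace_lipfree])

lift_definition uminus_lipfree :: "'a lipfree \<Rightarrow> 'a lipfree" is uminus
  by (rule subspace_neg[OF subspace_lipfree])

lift_definition scaleR_lipfree :: "real \<Rightarrow> 'a lipfree \<Rightarrow> 'a lipfree" is "(*\<^sub>R)"
  by (rule subspace_scale[OF subspace_lipfree])

definition dist_lipfree :: "'a lipfree \<Rightarrow> 'a lipfree \<Rightarrow> real"
  where "dist_lipfree \<mu> \<nu> = norm (\<mu> - \<nu>)"

definition sgn_lipfree :: "'a lipfree \<Rightarrow> 'a lipfree"
  where "sgn_lipfree \<mu> = inverse (norm \<mu>) *\<^sub>R \<mu>"

definition uniformity_lipfree :: "('a lipfree \<times> 'a lipfree) filter"
  where "uniformity_lipfree = (INF e\<in>{0 <..}. principal {(\<mu>, \<nu>). dist \<mu> \<nu> < e})"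

definition open_lipfree :: "'a lipfree set \<Rightarrow> bool"
  where "open_lipfree S = (\<forall>\<mu>\<in>S. \<forall>\<^sub>F (\<mu>', \<nu>) in uniformity. \<mu>' = \<mu> \<longrightarrow> \<nu> \<in> S)"

instance
  apply standard
  unfolding dist_lipfree_def sgn_lipfree_def uniformity_lipfree_def open_lipfree_def
  apply (rule refl | (transfer, simp add: algebra_simps norm_triangle_ineq))+
  done

end

lemma dist_lipfree_dual: "dist (lipfree_dual \<mu>) (lipfree_dual \<nu>) = dist \<mu> \<nu>"
  by (simp add: dist_norm norm_lipfree.rep_eq minus_lipfree.rep_eq)

instance lipfree :: (real_normed_vector) banach
proof
  fix X :: "nat \<Rightarrow> 'a lipfree"
  assume "Cauchy X"
  then have "Cauchy (\<lambda>n. lipfree_dual (X n))"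
    by (simp add: Cauchy_def dist_lipfree_dual)
  then obtain l where l: "(\<lambda>n. lipfree_dual (X n)) \<longlonglongrightarrow> l"
    using Cauchy_convergent convergent_def by blast
  have "l \<in> closure (span (range (dirac :: 'a \<Rightarrow> ('a, real) lip0 \<Rightarrow>\<^sub>L real)))"
    by (rule closed_sequentially[OF closed_closure lipfree_dual l])
  then obtain m where "l = lipfree_dual m"
    by (metis Lipfree_inverse)
  with l have "X \<longlonglongrightarrow> m"
    by (simp add: lim_sequentially dist_lipfree_dual)
  then show "convergent X" by (auto simp: convergent_def)
qed

lift_definition delta :: "'a::real_normed_vector \<Rightarrow> 'a lipfree" is dirac
  by (meson closure_subset range_eqI span_base subsetD)

definition linearization :: "('a::real_normed_vector, 'b::banach) lip0 \<Rightarrow> ('a lipfree \<Rightarrow>\<^sub>L 'b)" where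
  "linearization f = (THE L. \<forall>x. blinfun_apply L (delta x) = lip0_apply f x)"

definition barycenter :: "'a::banach lipfree \<Rightarrow>\<^sub>L 'a" where
  "barycenter = (THE B. \<forall>(\<phi> :: 'a \<Rightarrow>\<^sub>L real) \<mu>. blinfun_apply \<phi> (blinfun_apply B \<mu>) = lipfree_dual \<mu> (lip0_of_blinfun \<phi>))"

text \<open>
  Well-definedness of \<open>linearization\<close> and \<open>barycenter\<close>; uniqueness of the values of the latter needs
  the Hahn-Banach theorem, in the form that bounded functionals are norming.
\<close>

lemma ex_norming_functional:
  fixes y :: "'a::real_normed_vector"
  shows "\<exists>\<phi> :: 'a \<Rightarrow>\<^sub>L real. norm \<phi> \<le> 1 \<and> blinfun_apply \<phi> y = norm y"
proof -
  let ?P = "{G :: ('a \<times> real) set. subspace G \<and> (y, norm y) \<in> G \<and> (\<forall>(x, r)\<in>G. r \<le> norm x)}"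
  have "span {(y, norm y)} \<in> ?P"
  proof (intro CollectI conjI)
    show "\<forall>(x, r)\<in>span {(y, norm y)}. r \<le> norm x"
      by (auto simp: span_singleton intro: mult_right_mono)
  qed (auto intro: span_base)
  moreover have "\<Union>C \<in> ?P" if C: "C \<noteq> {}" "subset.chain ?P C" for C
  proof -
    have G: "G \<in> ?P" if "G \<in> C" for G using that C(2) unfolding subset.chain_def by blast
    have "subspace (\<Union>C)"
      unfolding subspace_def
    proof (intro conjI ballI allI)
      obtain G' where "G' \<in> C" using C(1) by blast
      with G[of G'] show "0 \<in> \<Union>C" using subspace_0 by blast
    next
      fix p q assume "p \<in> \<Union>C" "q \<in> \<Union>C"
      then obtain G H where GH: "G \<in> C" "p \<in> G" "H \<in> C" "q \<in> H" by auto
      then have "G \<subseteq> H \<or> H \<subseteq> G" using C(2) unfolding subset.chain_def by blast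
      then have "p + q \<in> G \<or> p + q \<in> H"
        using GH G[of G] G[of H] subspace_add by blast
      then show "p + q \<in> \<Union>C" using GH by blast
    next
      fix p and r :: real assume "p \<in> \<Union>C"
      then obtain G' where "G' \<in> C" "p \<in> G'" by blast
      then show "r *\<^sub>R p \<in> \<Union>C" using G[of G'] subspace_scale by blast
    qed
    moreover have "(y, norm y) \<in> \<Union>C" using C(1) G by blast
    moreover have "\<forall>(x, r)\<in>\<Union>C. r \<le> norm x" using G by blast
    ultimately show ?thesis by blast
  qed
  ultimately obtain M where "M \<in> ?P" and max: "\<And>X. X \<in> ?P \<Longrightarrow> M \<subseteq> X \<Longrightarrow> X = M"
    using subset_Zorn_nonempty[of ?P] by (metis (no_types, lifting) empty_iff)
  then have M: "subspace M" "(y, norm y) \<in> M" and le: "\<And>x r. (x, r) \<in> M \<Longrightarrow> r \<le> norm x"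
    by auto
  have neg: "(- x, - r) \<in> M" if "(x, r) \<in> M" for x r
    using subspace_neg[OF M(1) that] by simp
  have scale: "(t *\<^sub>R x, t * r) \<in> M" if "(x, r) \<in> M" for x r t
    using subspace_scale[OF M(1) that, of t] by simp
  have uniq: "r = s" if "(x, r) \<in> M" "(x, s) \<in> M" for x r s
    using le[of 0 "r - s"] le[of 0 "s - r"] subspace_diff[OF M(1) that] subspace_diff[OF M(1) that(2,1)]
    by simp
  have total: "\<exists>r. (z, r) \<in> M" for z
  proof -
    define c where "c = (SUP (u, r)\<in>M. r - norm (u - z))"
    have b: "r - norm (u - z) \<le> norm (v + z) - s" if "(u, r) \<in> M" "(v, s) \<in> M" for u r v s
      using le[of "u + v" "r + s"] subspace_add[OF M(1) that] norm_triangle_ineq[of "u - z" "v + z"]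
      by simp
    have bdd: "bdd_above ((\<lambda>(u, r). r - norm (u - z)) ` M)"
      using b[OF _ M(2)] by (auto intro!: bdd_aboveI2)
    have lo: "r - norm (u - z) \<le> c" if "(u, r) \<in> M" for u r
      unfolding c_def by (rule cSUP_upper2[OF bdd that]) auto
    have hi: "c \<le> norm (v + z) - s" if "(v, s) \<in> M" for v s
      unfolding c_def using M(2) b[OF _ that] by (intro cSUP_least) auto
    have key: "r + t * c \<le> norm (u + t *\<^sub>R z)" if m: "(u, r) \<in> M" for u r t
    proof (cases t "0 :: real" rule: linorder_cases)
      case equal then show ?thesis using le[OF m] by simp
    next
      case greater
      have "t * c \<le> t * (norm ((1/t) *\<^sub>R u + z) - (1/t) * r)"
        using greater hi[OF scale[OF m, of "1/t"]] by (intro mult_left_mono) auto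
      moreover have "t * (norm ((1/t) *\<^sub>R u + z) - (1/t) * r) = t * norm ((1/t) *\<^sub>R u + z) - r"
        using greater by (simp add: right_diff_distrib)
      moreover have "u + t *\<^sub>R z = t *\<^sub>R ((1/t) *\<^sub>R u + z)"
        using greater by (simp add: scaleR_add_right)
      then have "t * norm ((1/t) *\<^sub>R u + z) = norm (u + t *\<^sub>R z)"
        using greater by (metis abs_of_pos norm_scaleR)
      ultimately show ?thesis by linarith
    next
      case less
      define s where "s = - t"
      have s: "s > 0" using less by (simp add: s_def)
      have "s * ((1/s) * r - norm ((1/s) *\<^sub>R u - z)) \<le> s * c"
        using s lo[OF scale[OF m, of "1/s"]] by (intro mult_left_mono) auto
      moreover have "s * ((1/s) * r - norm ((1/s) *\<^sub>R u - z)) = r - s * norm ((1/s) *\<^sub>R u - z)"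
        using s by (simp add: right_diff_distrib)
      moreover have "u + t *\<^sub>R z = s *\<^sub>R ((1/s) *\<^sub>R u - z)"
        using s by (simp add: scaleR_diff_right) (simp add: s_def)
      then have "s * norm ((1/s) *\<^sub>R u - z) = norm (u + t *\<^sub>R z)"
        using s by (metis abs_of_pos norm_scaleR)
      ultimately have "r - s * c \<le> norm (u + t *\<^sub>R z)" by linarith
      then show ?thesis by (simp add: s_def)
    qed
    let ?X = "span (insert (z, c) M)"
    have "?X \<in> ?P"
    proof (intro CollectI conjI)
      show "(y, norm y) \<in> ?X" using M(2) by (auto intro: span_base)
      have "r \<le> norm x" if xr: "(x, r) \<in> ?X" for x r
      proof -
        obtain k where "(x, r) - k *\<^sub>R (z, c) \<in> span M"
          using span_breakdown_eq[THEN iffD1, OF xr] by blast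
        then have "(x - k *\<^sub>R z, r - k * c) \<in> M"
          using M(1) by (simp add: span_eq_iff[THEN iffD2])
        from key[OF this, of k] show ?thesis by simp
      qed
      then show "\<forall>(x, r)\<in>?X. r \<le> norm x" by auto
    qed simp
    then have "?X = M" by (rule max) (auto intro: span_base)
    then show ?thesis by (metis insertI1 span_base)
  qed
  define \<phi> where "\<phi> x = (THE r. (x, r) \<in> M)" for x
  have \<phi>: "\<phi> x = r \<longleftrightarrow> (x, r) \<in> M" for x r
    using total[of x] uniq unfolding \<phi>_def by (metis the_equality)
  have le': "\<bar>\<phi> x\<bar> \<le> norm x" for x
    using le[of x "\<phi> x"] le[of "- x" "- \<phi> x"] neg[of x "\<phi> x"] \<phi>[of x "\<phi> x"] by simp
  have "bounded_linear \<phi>"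
  proof
    show "\<phi> (a + b) = \<phi> a + \<phi> b" for a b
      using subspace_add[OF M(1), of "(a, \<phi> a)" "(b, \<phi> b)"] \<phi> by auto
    show "\<phi> (t *\<^sub>R a) = t *\<^sub>R \<phi> a" for t a
      using scale[of a "\<phi> a" t] \<phi> by auto
    show "\<exists>K. \<forall>x. norm (\<phi> x) \<le> norm x * K"
      using le' by (intro exI[of _ 1]) auto
  qed
  then show ?thesis
    using M(2) \<phi> le'
    by (intro exI[of _ "Blinfun \<phi>"])
      (auto simp: bounded_linear_Blinfun_apply intro!: norm_blinfun_bound)
qed

lemma functionals_separate:
  fixes y z :: "'a::real_normed_vector"
  assumes "\<And>\<phi> :: 'a \<Rightarrow>\<^sub>L real. blinfun_apply \<phi> y = blinfun_apply \<phi> z"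
  shows "y = z"
  using ex_norming_functional[of "y - z"] assms by (auto simp: blinfun.bilinear_simps)

lift_definition lip0_compose ::
    "('b::real_normed_vector \<Rightarrow>\<^sub>L 'c::real_normed_vector) \<Rightarrow> ('a::real_normed_vector, 'b) lip0 \<Rightarrow> ('a, 'c) lip0"
  is "\<lambda>T f x. T (f x)"
proof safe
  fix T :: "'b \<Rightarrow> 'c" and f :: "'a \<Rightarrow> 'b" and C
  assume T: "bounded_linear T" and f: "f 0 = 0" "C-lipschitz_on UNIV f"
  show "T (f 0) = 0" using T f by (simp add: linear_simps)
  have "norm (T (f x) - T (f y)) \<le> onorm T * lip_const f * norm (x - y)" for x y
    using order_trans[OF onorm[OF T, of "f x - f y"]
        mult_left_mono[OF lip_const_bound[OF f(2), of x y] onorm_pos_le[OF T]]]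
    by (simp add: linear_simps(2)[OF T] mult.assoc)
  then show "\<exists>C. C-lipschitz_on UNIV (\<lambda>x. T (f x))"
    using onorm_pos_le[OF T] lip_const_nonneg[OF f(2)]
    by (intro ex_lipschitzI[of "onorm T * lip_const f"]) auto
qed

lemma norm_lip0_compose_le: "norm (lip0_compose T f) \<le> norm T * norm f"
proof (rule norm_lip0_le)
  fix x y
  show "norm (lip0_apply (lip0_compose T f) x - lip0_apply (lip0_compose T f) y)
      \<le> norm T * norm f * norm (x - y)"
    using order_trans[OF norm_blinfun[of T "lip0_apply f x - lip0_apply f y"]
        mult_left_mono[OF lip0_bound[of f x y] norm_ge_zero[of T]]]
    by (simp add: lip0_compose.rep_eq blinfun.bilinear_simps mult.assoc)
qed simp

lemma lipfree_eq_zero: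
  fixes L :: "'a::real_normed_vector lipfree \<Rightarrow>\<^sub>L 'b::real_normed_vector"
  assumes "\<And>x. L (delta x) = 0"
  shows "L = 0"
proof -
  let ?F = "closure (span (range (dirac :: 'a \<Rightarrow> ('a, real) lip0 \<Rightarrow>\<^sub>L real)))"
  let ?Z = "lipfree_dual ` {\<mu>. L \<mu> = 0}"
  have "?F \<subseteq> ?Z"
  proof (rule closure_minimal)
    have "subspace ?Z"
    proof (rule subspaceI; (elim imageE CollectE)?; clarify?)
      show "0 \<in> ?Z"
        by (rule image_eqI[of _ _ 0]) (auto simp: zero_lipfree.rep_eq blinfun.bilinear_simps)
      fix \<mu> assume \<mu>: "L \<mu> = 0"
      show "r *\<^sub>R lipfree_dual \<mu> \<in> ?Z" for r
        by (rule image_eqI[of _ _ "r *\<^sub>R \<mu>"])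
          (auto simp: \<mu> scaleR_lipfree.rep_eq blinfun.bilinear_simps)
      fix \<nu> assume \<nu>: "L \<nu> = 0"
      show "lipfree_dual \<mu> + lipfree_dual \<nu> \<in> ?Z"
        by (rule image_eqI[of _ _ "\<mu> + \<nu>"])
          (auto simp: \<mu> \<nu> plus_lipfree.rep_eq blinfun.bilinear_simps)
    qed
    then show "span (range dirac) \<subseteq> ?Z"
      using assms by (intro span_minimal) (force simp: delta.rep_eq)
    show "closed ?Z"
    proof (rule closed_sequential_limits[THEN iffD2], safe)
      fix s l assume s: "\<forall>n. s n \<in> ?Z" and l: "s \<longlonglongrightarrow> l"
      then obtain t where t: "\<And>n. s n = lipfree_dual (t n)" "\<And>n. L (t n) = 0"
      proof -
        have "\<forall>n. \<exists>\<mu>. s n = lipfree_dual \<mu> \<and> L \<mu> = 0" using s by blast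
        then show ?thesis using that by metis
      qed
      have "l \<in> ?F"
        by (rule closed_sequentially[OF closed_closure _ l]) (simp add: t lipfree_dual)
      then obtain m where m: "l = lipfree_dual m"
        using Lipfree_inverse[symmetric] by blast
      have "t \<longlonglongrightarrow> m"
        using l unfolding m t by (simp add: lim_sequentially dist_lipfree_dual)
      then have "(\<lambda>n. L (t n)) \<longlonglongrightarrow> L m" by (intro tendsto_intros)
      then have "L m = 0" using t(2) by (simp add: LIMSEQ_const_iff)
      then show "l \<in> ?Z" using m by auto
    qed
  qed
  then have "L \<mu> = 0" for \<mu>
    using lipfree_dual[of \<mu>] by (auto simp: lipfree_dual_inject)
  then show ?thesis by (intro blinfun_eqI) simp
qed

lemma lipfree_weak_value:
  fixes f :: "('a::real_normed_vector, 'b::banach) lip0"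
  shows "\<exists>y. \<forall>\<phi>. blinfun_apply \<phi> y = lipfree_dual \<mu> (lip0_compose \<phi> f)"
proof -
  let ?R = "\<lambda>(m :: ('a, real) lip0 \<Rightarrow>\<^sub>L real) y. \<forall>\<phi>. blinfun_apply \<phi> y = m (lip0_compose \<phi> f)"
  have bound: "norm y \<le> norm m * norm f" if y: "?R m y" for m y
  proof -
    obtain \<phi> :: "'b \<Rightarrow>\<^sub>L real" where \<phi>: "norm \<phi> \<le> 1" "\<phi> y = norm y"
      using ex_norming_functional by blast
    have "norm y \<le> norm m * norm (lip0_compose \<phi> f)"
      using norm_blinfun[of m "lip0_compose \<phi> f"] y \<phi> by (metis abs_norm_cancel real_norm_def)
    also have "\<dots> \<le> norm m * (1 * norm f)"
      using order_trans[OF norm_lip0_compose_le[of \<phi> f] mult_right_mono[OF \<phi>(1) norm_ge_zero[of f]]]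
      by (intro mult_left_mono) auto
    finally show ?thesis by simp
  qed
  have diff: "?R (m - n) (y - z)" if "?R m y" "?R n z" for m n y z
    using that by (simp add: blinfun.bilinear_simps)
  have "closure (span (range dirac)) \<subseteq> {m. \<exists>y. ?R m y}"
  proof (rule closure_minimal)
    have "subspace {m. \<exists>y. ?R m y}"
      unfolding subspace_def
    proof (safe, goal_cases)
      case 1 show ?case by (intro exI[of _ 0]) (simp add: blinfun.bilinear_simps)
    next
      case (2 m n y z) then show ?case by (intro exI[of _ "y + z"]) (simp add: blinfun.bilinear_simps)
    next
      case (3 r m y) then show ?case by (intro exI[of _ "r *\<^sub>R y"]) (simp add: blinfun.bilinear_simps)
    qed
    moreover have "?R (dirac x) (lip0_apply f x)" for x
      by (simp add: dirac.rep_eq lip0_compose.rep_eq)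
    ultimately show "span (range dirac) \<subseteq> {m. \<exists>y. ?R m y}"
      by (intro span_minimal) auto
    show "closed {m. \<exists>y. ?R m y}"
    proof (rule closed_sequential_limits[THEN iffD2], safe)
      fix s m assume "\<forall>n. s n \<in> {m. \<exists>y. ?R m y}" and m: "s \<longlonglongrightarrow> m"
      then obtain t where t: "\<And>n. ?R (s n) (t n)" by simp metis
      have d: "dist (t i) (t j) \<le> dist (s i) (s j) * norm f" for i j
        using bound[OF diff[OF t t]] by (simp add: dist_norm)
      have "Cauchy s" using m by (rule LIMSEQ_imp_Cauchy)
      have "Cauchy t"
      proof (rule metric_CauchyI)
        fix e :: real assume "0 < e"
        then have e: "0 < e / (norm f + 1)" by (simp add: add_nonneg_pos)
        obtain N where N: "\<And>i j. i \<ge> N \<Longrightarrow> j \<ge> N \<Longrightarrow> dist (s i) (s j) < e / (norm f + 1)"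
          using metric_CauchyD[OF \<open>Cauchy s\<close> e] by blast
        have "dist (t i) (t j) < e" if "i \<ge> N" "j \<ge> N" for i j
        proof -
          have "dist (t i) (t j) \<le> dist (s i) (s j) * (norm f + 1)"
            using d[of i j] by (simp add: distrib_left add_increasing2)
          also have "\<dots> < e / (norm f + 1) * (norm f + 1)"
            using N[OF that] by (intro mult_strict_right_mono) (auto simp: add_nonneg_pos)
          also have "\<dots> = e" using norm_ge_zero[of f] by (simp add: add_nonneg_eq_0_iff)
          finally show ?thesis .
        qed
        then show "\<exists>M. \<forall>i\<ge>M. \<forall>j\<ge>M. dist (t i) (t j) < e" by blast
      qed
      then obtain y where y: "t \<longlonglongrightarrow> y" using Cauchy_convergent convergent_def by blast
      have "?R m y"
      proof
        fix \<phi> :: "'b \<Rightarrow>\<^sub>L real"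
        have "(\<lambda>n. \<phi> (t n)) \<longlonglongrightarrow> \<phi> y" using y by (intro tendsto_intros)
        moreover have "(\<lambda>n. \<phi> (t n)) \<longlonglongrightarrow> m (lip0_compose \<phi> f)"
          using m t by (auto intro!: tendsto_intros)
        ultimately show "\<phi> y = m (lip0_compose \<phi> f)" by (rule LIMSEQ_unique)
      qed
      then show "\<exists>y. ?R m y" ..
    qed
  qed
  then show ?thesis using lipfree_dual[of \<mu>] by blast
qed

lemma ex_linearization:
  fixes f :: "('a::real_normed_vector, 'b::banach) lip0"
  shows "\<exists>L :: 'a lipfree \<Rightarrow>\<^sub>L 'b. norm L \<le> norm f \<and>
    (\<forall>\<phi> \<mu>. blinfun_apply \<phi> (blinfun_apply L \<mu>) = lipfree_dual \<mu> (lip0_compose \<phi> f))"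
proof -
  obtain l where l: "\<And>\<mu> \<phi>. blinfun_apply \<phi> (l \<mu>) = lipfree_dual \<mu> (lip0_compose \<phi> f)"
    using lipfree_weak_value[where f=f] by metis
  have le: "norm (l \<mu>) \<le> norm f * norm \<mu>" for \<mu>
  proof -
    obtain \<phi> :: "'b \<Rightarrow>\<^sub>L real" where \<phi>: "norm \<phi> \<le> 1" "\<phi> (l \<mu>) = norm (l \<mu>)"
      using ex_norming_functional by blast
    have "norm (l \<mu>) \<le> norm (lipfree_dual \<mu>) * norm (lip0_compose \<phi> f)"
      using norm_blinfun[of "lipfree_dual \<mu>" "lip0_compose \<phi> f"] l[of \<phi> \<mu>] \<phi>
      by (metis abs_norm_cancel real_norm_def)
    also have "\<dots> \<le> norm (lipfree_dual \<mu>) * (1 * norm f)"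
      using order_trans[OF norm_lip0_compose_le[of \<phi> f] mult_right_mono[OF \<phi>(1) norm_ge_zero[of f]]]
      by (intro mult_left_mono) auto
    finally show ?thesis by (simp add: norm_lipfree.rep_eq mult.commute)
  qed
  have "bounded_linear l"
  proof
    show "l (\<mu> + \<nu>) = l \<mu> + l \<nu>" for \<mu> \<nu>
      by (rule functionals_separate) (simp add: l blinfun.bilinear_simps plus_lipfree.rep_eq)
    show "l (r *\<^sub>R \<mu>) = r *\<^sub>R l \<mu>" for r \<mu>
      by (rule functionals_separate) (simp add: l blinfun.bilinear_simps scaleR_lipfree.rep_eq)
    show "\<exists>K. \<forall>\<mu>. norm (l \<mu>) \<le> norm \<mu> * K"
      using le by (auto simp: mult.commute intro!: exI[of _ "norm f"])
  qed
  then show ?thesis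
    using l le by (intro exI[of _ "Blinfun l"])
      (auto simp: bounded_linear_Blinfun_apply intro!: norm_blinfun_bound)
qed

lemma linearization_unique:
  fixes L :: "'a::real_normed_vector lipfree \<Rightarrow>\<^sub>L 'b::banach"
  assumes "\<And>x. L (delta x) = lip0_apply f x"
  shows "linearization f = L"
  unfolding linearization_def
proof (rule the_equality)
  fix L' assume "\<forall>x. blinfun_apply L' (delta x) = lip0_apply f x"
  then have "L' - L = 0"
    using assms by (intro lipfree_eq_zero) (simp add: blinfun.bilinear_simps)
  then show "L' = L" by simp
qed (use assms in simp)

lemma
  fixes f :: "('a::real_normed_vector, 'b::banach) lip0"
  shows linearization_delta: "linearization f (delta x) = lip0_apply f x"
    and norm_linearization_le: "norm (linearization f) \<le> norm f"
    and linearization_weak: "blinfun_apply \<phi> (linearization f \<mu>) = lipfree_dual \<mu> (lip0_compose \<phi> f)"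
proof -
  obtain L :: "'a lipfree \<Rightarrow>\<^sub>L 'b" where L: "norm L \<le> norm f"
    "\<And>\<phi> \<mu>. blinfun_apply \<phi> (blinfun_apply L \<mu>) = lipfree_dual \<mu> (lip0_compose \<phi> f)"
    using ex_linearization[of f] by blast
  have d: "L (delta x) = lip0_apply f x" for x
    by (rule functionals_separate) (simp add: L delta.rep_eq dirac.rep_eq lip0_compose.rep_eq)
  then have "linearization f = L" by (rule linearization_unique)
  then show "linearization f (delta x) = lip0_apply f x" "norm (linearization f) \<le> norm f"
    "blinfun_apply \<phi> (linearization f \<mu>) = lipfree_dual \<mu> (lip0_compose \<phi> f)"
    using d L by auto
qed

lemma barycenter_weak:
  fixes \<phi> :: "'a::banach \<Rightarrow>\<^sub>L real"
  shows "blinfun_apply \<phi> (barycenter \<mu>) = lipfree_dual \<mu> (lip0_of_blinfun \<phi>)"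
proof -
  let ?P = "\<lambda>B :: 'a lipfree \<Rightarrow>\<^sub>L 'a.
    \<forall>(\<phi> :: 'a \<Rightarrow>\<^sub>L real) \<mu>. blinfun_apply \<phi> (blinfun_apply B \<mu>) = lipfree_dual \<mu> (lip0_of_blinfun \<phi>)"
  have "lip0_compose \<phi> (lip0_of_blinfun id_blinfun) = lip0_of_blinfun \<phi>" for \<phi> :: "'a \<Rightarrow>\<^sub>L real"
    by (rule lip0_eqI) (simp add: lip0_compose.rep_eq lip0_of_blinfun.rep_eq)
  then have P: "?P (linearization (lip0_of_blinfun id_blinfun))"
    by (simp add: linearization_weak)
  have "B = linearization (lip0_of_blinfun id_blinfun)" if B: "?P B" for B
  proof (rule blinfun_eqI, rule functionals_separate)
    fix \<mu> and \<phi> :: "'a \<Rightarrow>\<^sub>L real"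
    show "\<phi> (B \<mu>) = \<phi> (linearization (lip0_of_blinfun id_blinfun) \<mu>)"
      using B P by metis
  qed
  then have "barycenter = linearization (lip0_of_blinfun (id_blinfun :: 'a \<Rightarrow>\<^sub>L 'a))"
    unfolding barycenter_def using P by (intro the_equality)
  then show ?thesis using P by simp
qed

lemma barycenter_delta: "barycenter (delta x) = x" for x :: "'a::banach"
  by (rule functionals_separate)
    (simp add: barycenter_weak delta.rep_eq dirac.rep_eq lip0_of_blinfun.rep_eq)

definition isometric_lifting_property :: "'a::banach itself \<Rightarrow> bool" where
  "isometric_lifting_property _ \<longleftrightarrow>
     (\<exists>U :: 'a \<Rightarrow>\<^sub>L 'a lipfree. norm U = 1 \<and> barycenter o\<^sub>L U = id_blinfun)"

section \<open>Operator ideals\<close>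

text \<open>
  An operator ideal assigns a set of operators to every pair of Banach spaces. As HOL does not
  quantify over types, ideals live on the class of all Banach spaces whose underlying set is
  contained in a type \<open>'u\<close>, the universe; results are stated for an arbitrary \<open>'u\<close>.
\<close>

record 'u bspace =
  carrier :: "'u set"
  zero :: 'u
  add :: "'u \<Rightarrow> 'u \<Rightarrow> 'u"
  scale :: "real \<Rightarrow> 'u \<Rightarrow> 'u"
  nrm :: "'u \<Rightarrow> real"

locale banach_space =
  fixes E :: "'u bspace"
  assumes zero_closed: "zero E \<in> carrier E"
    and add_closed: "\<lbrakk>x \<in> carrier E; y \<in> carrier E\<rbrakk> \<Longrightarrow> add E x y \<in> carrier E"
    and scale_closed: "x \<in> carrier E \<Longrightarrow> scale E r x \<in> carrier E"
    and add_assoc: "\<lbrakk>x \<in> carrier E; y \<in> carrier E; z \<in> carrier E\<rbrakk> \<Longrightarrow>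
      add E (add E x y) z = add E x (add E y z)"
    and add_commute: "\<lbrakk>x \<in> carrier E; y \<in> carrier E\<rbrakk> \<Longrightarrow> add E x y = add E y x"
    and add_zero: "x \<in> carrier E \<Longrightarrow> add E (zero E) x = x"
    and add_inverse: "x \<in> carrier E \<Longrightarrow> add E x (scale E (-1) x) = zero E"
    and scale_add: "\<lbrakk>x \<in> carrier E; y \<in> carrier E\<rbrakk> \<Longrightarrow>
      scale E r (add E x y) = add E (scale E r x) (scale E r y)"
    and add_scale: "x \<in> carrier E \<Longrightarrow> scale E (r + s) x = add E (scale E r x) (scale E s x)"
    and scale_scale: "x \<in> carrier E \<Longrightarrow> scale E r (scale E s x) = scale E (r * s) x"
    and scale_one: "x \<in> carrier E \<Longrightarrow> scale E 1 x = x"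
    and nrm_eq_0: "x \<in> carrier E \<Longrightarrow> nrm E x = 0 \<longleftrightarrow> x = zero E"
    and nrm_nonneg: "x \<in> carrier E \<Longrightarrow> 0 \<le> nrm E x"
    and nrm_triangle: "\<lbrakk>x \<in> carrier E; y \<in> carrier E\<rbrakk> \<Longrightarrow> nrm E (add E x y) \<le> nrm E x + nrm E y"
    and nrm_scale: "x \<in> carrier E \<Longrightarrow> nrm E (scale E r x) = \<bar>r\<bar> * nrm E x"
    and complete: "Metric_space.mcomplete (carrier E) (\<lambda>x y. nrm E (add E x (scale E (-1) y)))"

definition bounded_operators :: "'u bspace \<Rightarrow> 'u bspace \<Rightarrow> ('u \<Rightarrow> 'u) set" where
  "bounded_operators E F = {T \<in> carrier E \<rightarrow>\<^sub>E carrier F.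
     (\<forall>x\<in>carrier E. \<forall>y\<in>carrier E. T (add E x y) = add F (T x) (T y)) \<and>
     (\<forall>r. \<forall>x\<in>carrier E. T (scale E r x) = scale F r (T x)) \<and>
     (\<exists>C. \<forall>x\<in>carrier E. nrm F (T x) \<le> C * nrm E x)}"

definition bounded_functionals :: "'u bspace \<Rightarrow> ('u \<Rightarrow> real) set" where
  "bounded_functionals E = {\<phi>.
     (\<forall>x\<in>carrier E. \<forall>y\<in>carrier E. \<phi> (add E x y) = \<phi> x + \<phi> y) \<and>
     (\<forall>r. \<forall>x\<in>carrier E. \<phi> (scale E r x) = r * \<phi> x) \<and>
     (\<exists>C. \<forall>x\<in>carrier E. \<bar>\<phi> x\<bar> \<le> C * nrm E x)}"

text \<open>
  Rank-one operators and closure under sums give all finite-rank operators. The sets \<open>A E F\<close> are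
  unconstrained when \<open>E\<close> or \<open>F\<close> is not a Banach space.
\<close>

locale operator_ideal =
  fixes A :: "'u bspace \<Rightarrow> 'u bspace \<Rightarrow> ('u \<Rightarrow> 'u) set"
  assumes bounded: "\<lbrakk>banach_space E; banach_space F\<rbrakk> \<Longrightarrow> A E F \<subseteq> bounded_operators E F"
    and rank_one: "\<lbrakk>banach_space E; banach_space F; \<phi> \<in> bounded_functionals E; y \<in> carrier F\<rbrakk> \<Longrightarrow>
      (\<lambda>x\<in>carrier E. scale F (\<phi> x) y) \<in> A E F"
    and add_mem: "\<lbrakk>banach_space E; banach_space F; S \<in> A E F; T \<in> A E F\<rbrakk> \<Longrightarrow>
      (\<lambda>x\<in>carrier E. add F (S x) (T x)) \<in> A E F"
    and scale_mem: "\<lbrakk>banach_space E; banach_space F; T \<in> A E F\<rbrakk> \<Longrightarrow>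
      (\<lambda>x\<in>carrier E. scale F r (T x)) \<in> A E F"
    and comp_mem: "\<lbrakk>banach_space D; banach_space E; banach_space F; banach_space G;
        T \<in> bounded_operators D E; S \<in> A E F; R \<in> bounded_operators F G\<rbrakk> \<Longrightarrow>
      (\<lambda>x\<in>carrier D. R (S (T x))) \<in> A D G"

text \<open>
  The copy in the universe of a Banach space given by a type, along an injection \<open>e\<close> into the
  universe: \<open>e\<close> is an isometric isomorphism onto it. As ideals are invariant under isomorphisms,
  \<open>T\<close> belongs to the ideal iff its copy does, for any choice of injections
  (\<open>ideal_operators_iff\<close> below). If one of the types does not inject into the universe, there
  are no ideal operators between them; \<open>'u\<close> being arbitrary, it can be taken large enough for
  any given types.
\<close>

definition bspace_of :: "('a::real_normed_vector \<Rightarrow> 'u) \<Rightarrow> 'u bspace" where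
  "bspace_of e = \<lparr>carrier = range e, zero = e 0, add = (\<lambda>u v. e (inv e u + inv e v)),
     scale = (\<lambda>r u. e (r *\<^sub>R inv e u)), nrm = (\<lambda>u. norm (inv e u))\<rparr>"

definition operator_of ::
    "('a::real_normed_vector \<Rightarrow> 'u) \<Rightarrow> ('b::real_normed_vector \<Rightarrow> 'u) \<Rightarrow> ('a \<Rightarrow>\<^sub>L 'b) \<Rightarrow> 'u \<Rightarrow> 'u" where
  "operator_of e e' T = (\<lambda>u\<in>range e. e' (T (inv e u)))"

definition ideal_operators ::
    "('u bspace \<Rightarrow> 'u bspace \<Rightarrow> ('u \<Rightarrow> 'u) set) \<Rightarrow> ('a::banach \<Rightarrow>\<^sub>L 'b::banach) set" where
  "ideal_operators A = {T. \<exists>(e :: 'a \<Rightarrow> 'u) (e' :: 'b \<Rightarrow> 'u). inj e \<and> inj e' \<and>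
     operator_of e e' T \<in> A (bspace_of e) (bspace_of e')}"

definition lip_ideal_operators ::
    "('u bspace \<Rightarrow> 'u bspace \<Rightarrow> ('u \<Rightarrow> 'u) set) \<Rightarrow> ('a::banach, 'b::banach) lip0 set" where
  "lip_ideal_operators A = {f. linearization f \<in> ideal_operators A}"

lemma banach_space_bspace_of:
  fixes e :: "'a::banach \<Rightarrow> 'u"
  assumes e: "inj e"
  shows "banach_space (bspace_of e)"
proof
  let ?d = "\<lambda>x y. nrm (bspace_of e) (add (bspace_of e) x (scale (bspace_of e) (-1) y))"
  have d: "?d (e x) (e y) = dist x y" for x y
    using e by (simp add: bspace_of_def dist_norm)
  interpret M: Metric_space "range e" ?d
  proof
    show "0 \<le> ?d x y" for x y by (simp add: bspace_of_def)
    show "?d x y = ?d y x" for x y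
      using e by (simp add: bspace_of_def norm_minus_commute)
    show "?d x y = 0 \<longleftrightarrow> x = y" if "x \<in> range e" "y \<in> range e" for x y
      using that by (auto simp: d inj_eq[OF e] simp del: bspace.simps)
    show "?d x z \<le> ?d x y + ?d y z"
      if "x \<in> range e" "y \<in> range e" "z \<in> range e" for x y z
      using that by (auto simp only: d dist_triangle)
  qed
  have "M.mcomplete"
    unfolding M.mcomplete_def
  proof safe
    fix s assume s: "M.MCauchy s"
    then have r: "s n \<in> range e" for n
      by (auto simp: M.MCauchy_def)
    define t where "t n = inv e (s n)" for n
    have t: "s n = e (t n)" for n
      using r[of n] by (simp add: t_def f_inv_into_f)
    have "Cauchy t"
      using s unfolding M.MCauchy_def t d Cauchy_def by (metis nle_le)
    then obtain l where "t \<longlonglongrightarrow> l"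
      using Cauchy_convergent convergent_def by blast
    then have "limitin M.mtopology s (e l) sequentially"
      unfolding M.limit_metric_sequentially t d lim_sequentially by (auto simp: d)
    then show "\<exists>x. limitin M.mtopology s x sequentially" ..
  qed
  then show "Metric_space.mcomplete (carrier (bspace_of e)) ?d"
    by (simp add: bspace_of_def)
qed (use e in \<open>auto simp: bspace_of_def algebra_simps norm_triangle_ineq inj_eq\<close>)


lemma operator_of_bounded:
  fixes e :: "'a::banach \<Rightarrow> 'u" and e' :: "'b::banach \<Rightarrow> 'u"
  assumes e: "inj e" "inj e'"
  shows "operator_of e e' T \<in> bounded_operators (bspace_of e) (bspace_of e')"
  using e norm_blinfun[of T]
  by (auto simp: bounded_operators_def operator_of_def bspace_of_def blinfun.bilinear_simps
      mult.commute intro!: exI[of _ "norm T"])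

lemma (in operator_ideal) ideal_operators_iff:
  fixes e :: "'a::banach \<Rightarrow> 'u" and e' :: "'b::banach \<Rightarrow> 'u"
  assumes e: "inj e" "inj e'"
  shows "T \<in> ideal_operators A \<longleftrightarrow> operator_of e e' T \<in> A (bspace_of e) (bspace_of e')"
proof
  assume "T \<in> ideal_operators A"
  then obtain i :: "'a \<Rightarrow> 'u" and j :: "'b \<Rightarrow> 'u"
    where i: "inj i" "inj j" and T: "operator_of i j T \<in> A (bspace_of i) (bspace_of j)"
    by (auto simp: ideal_operators_def)
  have "(\<lambda>u\<in>carrier (bspace_of e). operator_of j e' id_blinfun
      (operator_of i j T (operator_of e i id_blinfun u))) \<in> A (bspace_of e) (bspace_of e')"
    using e i T by (intro comp_mem[of _ "bspace_of i" "bspace_of j"])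
      (auto intro: banach_space_bspace_of operator_of_bounded)
  also have "(\<lambda>u\<in>carrier (bspace_of e). operator_of j e' id_blinfun
      (operator_of i j T (operator_of e i id_blinfun u))) = operator_of e e' T"
    using e i by (auto simp: operator_of_def bspace_of_def restrict_def)
  finally show "operator_of e e' T \<in> A (bspace_of e) (bspace_of e')" .
qed (use e in \<open>auto simp: ideal_operators_def\<close>)

section \<open>Approximation properties\<close>

definition compact_convergence :: "('a::topological_space \<Rightarrow> 'b::metric_space) topology" where
  \<comment> \<open>The topology of uniform convergence on compact sets.\<close>
  "compact_convergence = topology (\<lambda>\<U>. \<forall>f\<in>\<U>. \<exists>K e. compact K \<and> 0 < e \<and>
     {g. \<forall>x\<in>K. dist (f x) (g x) < e} \<subseteq> \<U>)"

lemma openin_compact_convergence: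
  "openin compact_convergence \<U> \<longleftrightarrow>
    (\<forall>f\<in>\<U>. \<exists>K e. compact K \<and> 0 < e \<and> {g. \<forall>x\<in>K. dist (f x) (g x) < e} \<subseteq> \<U>)"
    (is "_ \<longleftrightarrow> ?P \<U>")
proof -
  have "?P (S \<inter> T)" if S: "?P S" and T: "?P T" for S T
  proof
    fix f assume f: "f \<in> S \<inter> T"
    obtain K d where K: "compact K" "0 < d" "{g. \<forall>x\<in>K. dist (f x) (g x) < d} \<subseteq> S"
      using S f by (meson IntD1)
    obtain L e where L: "compact L" "0 < e" "{g. \<forall>x\<in>L. dist (f x) (g x) < e} \<subseteq> T"
      using T f by (meson IntD2)
    show "\<exists>K e. compact K \<and> 0 < e \<and> {g. \<forall>x\<in>K. dist (f x) (g x) < e} \<subseteq> S \<inter> T"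
      using K L by (intro exI[of _ "K \<union> L"] exI[of _ "min d e"]) (auto intro: compact_Un)
  qed
  moreover have "?P (\<Union>\<K>)" if "\<forall>S\<in>\<K>. ?P S" for \<K>
    using that by (meson UnionE Union_upper order_trans)
  ultimately have "istopology ?P"
    unfolding istopology_def by blast
  then show ?thesis
    unfolding compact_convergence_def by (simp add: topology_inverse')
qed

definition ideal_bap ::
    "'a::banach itself \<Rightarrow> ('u bspace \<Rightarrow> 'u bspace \<Rightarrow> ('u \<Rightarrow> 'u) set) \<Rightarrow> real \<Rightarrow> bool" where
  "ideal_bap _ A l \<longleftrightarrow> (id :: 'a \<Rightarrow> 'a) \<in> compact_convergence closure_of
     (blinfun_apply ` {T \<in> ideal_operators A. norm T \<le> l})"

definition lip_ideal_bap ::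
    "'a::banach itself \<Rightarrow> ('u bspace \<Rightarrow> 'u bspace \<Rightarrow> ('u \<Rightarrow> 'u) set) \<Rightarrow> real \<Rightarrow> bool" where
  "lip_ideal_bap _ A l \<longleftrightarrow> (id :: 'a \<Rightarrow> 'a) \<in> compact_convergence closure_of
     (lip0_apply ` {f \<in> lip_ideal_operators A. norm f \<le> l})"

end

theory Submission
  imports Defs
begin

text \<open>
  Let \<open>U\<close> be the isometric lifting and let \<open>f\<close> be a Lipschitz map with \<open>\<parallel>f\<parallel> \<le> l\<close> whose
  linearization \<open>L\<^sub>f\<close> lies in the ideal. Then \<open>L\<^sub>f U\<close> is a linear operator in the ideal with
  \<open>\<parallel>L\<^sub>f U\<parallel> \<le> \<parallel>L\<^sub>f\<parallel> \<parallel>U\<parallel> \<le> l\<close>. If \<open>f\<close> is close to the identity then so is \<open>L\<^sub>f U\<close>: since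
  \<open>\<beta> U = Id\<close>, the difference \<open>L\<^sub>f U x - x\<close> is the value of \<open>L\<^sub>f - \<beta>\<close> at \<open>U x\<close>, and \<open>L\<^sub>f - \<beta>\<close>
  takes the value \<open>f y - y\<close> at \<open>\<delta>\<^sub>y\<close>.

  What has to be explained is why smallness of \<open>f y - y\<close> gives smallness of \<open>L\<^sub>f - \<beta>\<close> on the
  compact set \<open>U K\<close>, which need not be contained in the span of the point masses. The operators
  \<open>L\<^sub>f - \<beta>\<close> are uniformly bounded, by \<open>l + \<parallel>\<beta>\<parallel>\<close>, and the point masses span a dense subspace of
  the free space; for a uniformly bounded family, smallness at suitable finitely many vectors of a
  set with dense span implies uniform smallness on a given compact set
  (\<open>uniformly_small_on_compact\<close>). So it is enough to approximate the identity by \<open>f\<close> on a finite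
  set of points.
\<close>

section \<open>Closures in the topology of compact convergence\<close>

lemma in_closure_of_compact_convergence:
  fixes f :: "'a::topological_space \<Rightarrow> 'b::metric_space"
  shows "f \<in> compact_convergence closure_of F \<longleftrightarrow>
    (\<forall>K e. compact K \<longrightarrow> 0 < e \<longrightarrow> (\<exists>g\<in>F. \<forall>x\<in>K. dist (f x) (g x) < e))"
    (is "_ \<longleftrightarrow> ?R")
proof
  assume f: "f \<in> compact_convergence closure_of F"
  show ?R
  proof (intro allI impI)
    fix K :: "'a set" and e :: real
    assume K: "compact K" "0 < e"
    \<comment> \<open>The set of all \<open>g\<close> with \<open>dist (f x) (g x) < e\<close> on \<open>K\<close> need not be open, as the functions
      are arbitrary and the supremum over \<open>K\<close> may be \<open>e\<close>; its subset \<open>?V\<close> is open.\<close>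
    let ?V = "{g. \<exists>r<e. \<forall>x\<in>K. dist (f x) (g x) \<le> r}"
    have "openin compact_convergence ?V"
      unfolding openin_compact_convergence
    proof
      fix g assume "g \<in> ?V"
      then obtain r where r: "r < e" "\<forall>x\<in>K. dist (f x) (g x) \<le> r" by auto
      have "{h. \<forall>x\<in>K. dist (g x) (h x) < (e - r) / 2} \<subseteq> ?V"
      proof safe
        fix h assume h: "\<forall>x\<in>K. dist (g x) (h x) < (e - r) / 2"
        have "dist (f x) (h x) \<le> r + (e - r) / 2" if "x \<in> K" for x
          using dist_triangle[of "f x" "h x" "g x"] bspec[OF r(2) that] bspec[OF h that] by linarith
        moreover have "r + (e - r) / 2 < e" using r(1) by (simp add: field_simps)
        ultimately show "\<exists>r<e. \<forall>x\<in>K. dist (f x) (h x) \<le> r" by blast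
      qed
      then show "\<exists>K e. compact K \<and> 0 < e \<and> {h. \<forall>x\<in>K. dist (g x) (h x) < e} \<subseteq> ?V"
        using K(1) r(1) by (intro exI[of _ K] exI[of _ "(e - r) / 2"]) simp
    qed
    moreover have "f \<in> ?V" using K(2) by (intro CollectI exI[of _ 0]) simp
    ultimately obtain g where "g \<in> F" "g \<in> ?V"
      using f[unfolded in_closure_of, THEN conjunct2, THEN spec, of ?V] by (elim impE exE conjE) simp_all
    then show "\<exists>g\<in>F. \<forall>x\<in>K. dist (f x) (g x) < e"
      by (blast intro: le_less_trans)
  qed
next
  assume R: ?R
  have "openin compact_convergence UNIV"
    unfolding openin_compact_convergence
    by (intro ballI exI[of _ "{}"] exI[of _ 1] conjI compact_empty zero_less_one subset_UNIV)
  then have "f \<in> topspace compact_convergence"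
    by (auto dest: openin_subset)
  moreover have "\<exists>g. g \<in> F \<and> g \<in> V" if V: "f \<in> V" "openin compact_convergence V" for V
  proof -
    obtain K e where "compact K" "0 < e" "{g. \<forall>x\<in>K. dist (f x) (g x) < e} \<subseteq> V"
      using V by (auto simp: openin_compact_convergence dest: bspec)
    moreover from this obtain g where "g \<in> F" "\<forall>x\<in>K. dist (f x) (g x) < e"
      using R by meson
    ultimately show ?thesis by auto
  qed
  ultimately show "f \<in> compact_convergence closure_of F"
    unfolding in_closure_of by simp
qed

section \<open>Bounded families of operators that are small on a set with dense span\<close>

text \<open>
  The set \<open>S\<close> consists of the vectors in a representation of \<open>v\<close> as a linear combination, and \<open>C\<close>
  is the sum of the absolute values of its coefficients; neither depends on the operator.
\<close>

lemma bound_on_span: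
  fixes v :: "'a::real_normed_vector"
  assumes "v \<in> span B"
  obtains S C where "finite S" "S \<subseteq> B" "0 \<le> C"
    "\<And>(L :: 'a \<Rightarrow>\<^sub>L 'b::real_normed_vector) d. (\<And>s. s \<in> S \<Longrightarrow> norm (L s) \<le> d) \<Longrightarrow> norm (L v) \<le> C * d"
proof -
  have "\<exists>S C. finite S \<and> S \<subseteq> B \<and> 0 \<le> C \<and>
    (\<forall>(L :: 'a \<Rightarrow>\<^sub>L 'b) d. (\<forall>s\<in>S. norm (L s) \<le> d) \<longrightarrow> norm (L v) \<le> C * d)"
    using assms
  proof (induction rule: span_induct_alt)
    case base
    show ?case by (intro exI[of _ "{}"] exI[of _ 0]) (simp add: blinfun.bilinear_simps)
  next
    case (step c b w)
    then obtain S C where S: "finite S" "S \<subseteq> B" "0 \<le> C"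
      and C: "\<And>(L :: 'a \<Rightarrow>\<^sub>L 'b) d. (\<forall>s\<in>S. norm (L s) \<le> d) \<Longrightarrow> norm (L w) \<le> C * d"
      by blast
    have "norm (L (c *\<^sub>R b + w)) \<le> (\<bar>c\<bar> + C) * d"
      if d: "\<forall>s\<in>insert b S. norm (L s) \<le> d" for L :: "'a \<Rightarrow>\<^sub>L 'b" and d
    proof -
      have "norm (L (c *\<^sub>R b + w)) \<le> \<bar>c\<bar> * norm (L b) + norm (L w)"
        using norm_triangle_ineq[of "c *\<^sub>R L b" "L w"] by (simp add: blinfun.bilinear_simps)
      also have "\<dots> \<le> \<bar>c\<bar> * d + C * d"
        using d C[of L d] by (intro add_mono mult_left_mono) auto
      finally show ?thesis by (simp add: distrib_right)
    qed
    then show ?case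
      using S step.hyps by (intro exI[of _ "insert b S"] exI[of _ "\<bar>c\<bar> + C"]) auto
  qed
  then show ?thesis using that by metis
qed

text \<open>
  By density, the compact set \<open>M\<close> is covered by finitely many small balls with centres in the span
  of \<open>B\<close>. At the centres \<open>bound_on_span\<close> applies; the bound \<open>R\<close> on the operator norms controls
  the error made by replacing a point of \<open>M\<close> by a centre.
\<close>

lemma uniformly_small_on_compact:
  fixes M :: "'a::real_normed_vector set"
  assumes dense: "closure (span B) = UNIV" and M: "compact M" and e: "0 < e" and R: "0 \<le> R"
  obtains S d where "finite S" "S \<subseteq> B" "0 < d"
    "\<And>(L :: 'a \<Rightarrow>\<^sub>L 'b::real_normed_vector) v.
      norm L \<le> R \<Longrightarrow> (\<And>s. s \<in> S \<Longrightarrow> norm (blinfun_apply L s) \<le> d) \<Longrightarrow> v \<in> M \<Longrightarrow>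
      norm (blinfun_apply L v) < e"
proof -
  define \<eta> where "\<eta> = e / (2 * (R + 1))"
  have \<eta>: "0 < \<eta>" "R * \<eta> < e / 2"
    using e R by (auto simp: \<eta>_def field_simps)
  have "M \<subseteq> (\<Union>w\<in>span B. ball w \<eta>)"
    using dense \<eta>(1) by (auto simp: set_eq_iff closure_approachable)
  then obtain D where D: "D \<subseteq> span B" "finite D" "M \<subseteq> (\<Union>w\<in>D. ball w \<eta>)"
    using compactE_image[OF M, of "span B" "\<lambda>w. ball w \<eta>"] by auto
  have "\<exists>S C. finite S \<and> S \<subseteq> B \<and> 0 \<le> C \<and>
    (\<forall>(L :: 'a \<Rightarrow>\<^sub>L 'b) d. (\<forall>s\<in>S. norm (L s) \<le> d) \<longrightarrow> norm (L w) \<le> C * d)" if "w \<in> D" for w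
    using bound_on_span[of w B, where 'b='b] D(1) that by (metis subsetD)
  then obtain S C where S: "\<And>w. w \<in> D \<Longrightarrow> finite (S w) \<and> S w \<subseteq> B \<and> 0 \<le> C w"
    and C: "\<And>w (L :: 'a \<Rightarrow>\<^sub>L 'b) d. w \<in> D \<Longrightarrow> (\<forall>s\<in>S w. norm (L s) \<le> d) \<Longrightarrow> norm (L w) \<le> C w * d"
    by metis
  define c where "c = 1 + (\<Sum>w\<in>D. C w)"
  have c: "0 < c"
    using S sum_nonneg[of D C] by (simp add: c_def add_pos_nonneg)
  have Cc: "C w \<le> c" if "w \<in> D" for w
    using S D(2) member_le_sum[of w D C] that by (simp add: c_def)
  define d where "d = e / (2 * c)"
  have d: "0 < d" "c * d = e / 2"
    using e c by (auto simp: d_def)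
  show ?thesis
  proof (rule that[of "\<Union>w\<in>D. S w" d])
    fix L :: "'a \<Rightarrow>\<^sub>L 'b" and v
    assume L: "norm L \<le> R" "\<And>s. s \<in> (\<Union>w\<in>D. S w) \<Longrightarrow> norm (blinfun_apply L s) \<le> d" and "v \<in> M"
    then obtain w where w: "w \<in> D" "dist w v < \<eta>" using D(3) by auto
    have "norm (L (v - w)) \<le> R * \<eta>"
      using norm_blinfun[of L "v - w"] mult_mono[OF L(1), of "norm (v - w)" \<eta>] w(2) R
      by (simp add: dist_norm norm_minus_commute)
    moreover have "norm (L w) \<le> c * d"
    proof (rule order_trans)
      show "norm (L w) \<le> C w * d" using C[OF w(1), of L d] L(2) w(1) by blast
      show "C w * d \<le> c * d" using Cc[OF w(1)] d(1) by (intro mult_right_mono) auto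
    qed
    moreover have "norm (L v) \<le> norm (L (v - w)) + norm (L w)"
      using norm_triangle_ineq[of "L (v - w)" "L w"] by (simp add: blinfun.bilinear_simps)
    ultimately show "norm (L v) < e" using \<eta>(2) d(2) by linarith
  qed (use S D(2) d(1) in auto)
qed

section \<open>Density of the span of the point masses\<close>

lemma closure_span_delta: "closure (span (range delta)) = (UNIV :: 'a::real_normed_vector lipfree set)"
proof -
  have "linear (lipfree_dual :: 'a lipfree \<Rightarrow> _)"
    by (rule linearI) (simp_all add: plus_lipfree.rep_eq scaleR_lipfree.rep_eq)
  moreover have "range (dirac :: 'a \<Rightarrow> _) = lipfree_dual ` range delta"
    by (simp add: image_image delta.rep_eq)
  ultimately have sp: "span (range (dirac :: 'a \<Rightarrow> _)) = lipfree_dual ` span (range delta)"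
    by (simp only: linear_span_image)
  have "\<mu> \<in> closure (span (range delta))" for \<mu> :: "'a lipfree"
    using lipfree_dual[of \<mu>] unfolding closure_approachable sp by (auto simp: dist_lipfree_dual)
  then show ?thesis by blast
qed

section \<open>Composition with bounded operators\<close>

lemma (in operator_ideal) ideal_operators_compose:
  fixes T :: "'a::banach \<Rightarrow>\<^sub>L 'b::banach" and S :: "'b \<Rightarrow>\<^sub>L 'c::banach" and i :: "'a \<Rightarrow> 'u"
  assumes i: "inj i" and "S \<in> ideal_operators A"
  shows "S o\<^sub>L T \<in> ideal_operators A"
proof -
  obtain e :: "'b \<Rightarrow> 'u" and e' :: "'c \<Rightarrow> 'u"
    where e: "inj e" "inj e'" and S: "operator_of e e' S \<in> A (bspace_of e) (bspace_of e')"
    using assms(2) by (auto simp: ideal_operators_def)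
  have "(\<lambda>u\<in>carrier (bspace_of i). operator_of e' e' id_blinfun
      (operator_of e e' S (operator_of i e T u))) \<in> A (bspace_of i) (bspace_of e')"
    using i e S by (intro comp_mem[of _ "bspace_of e" "bspace_of e'"])
      (auto intro: banach_space_bspace_of operator_of_bounded)
  also have "(\<lambda>u\<in>carrier (bspace_of i). operator_of e' e' id_blinfun
      (operator_of e e' S (operator_of i e T u))) = operator_of i e' (S o\<^sub>L T)"
    using i e by (auto simp: operator_of_def bspace_of_def restrict_def)
  finally show ?thesis
    using i e by (auto simp: ideal_operators_def)
qed

section \<open>From Lipschitz to linear approximations of the identity\<close>

theorem proposition3p3:
  fixes A :: "'u bspace \<Rightarrow> 'u bspace \<Rightarrow> ('u \<Rightarrow> 'u) set"
    and l :: real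
  assumes "operator_ideal A"
    and "l \<ge> 1"
    and "isometric_lifting_property TYPE('a::banach)"
    and "lip_ideal_bap TYPE('a) A l"
  shows "ideal_bap TYPE('a) A l"
proof -
  interpret operator_ideal A by fact
  obtain U :: "'a \<Rightarrow>\<^sub>L 'a lipfree" where U: "norm U = 1" "barycenter o\<^sub>L U = id_blinfun"
    using assms(3) unfolding isometric_lifting_property_def by blast
  have bU: "barycenter (U x) = x" for x
    using arg_cong[OF U(2), of "\<lambda>T. blinfun_apply T x"] by simp
  show ?thesis
    unfolding ideal_bap_def in_closure_of_compact_convergence
  proof (intro allI impI)
    fix K :: "'a set" and e :: real
    assume K: "compact K" and e: "0 < e"
    have UK: "compact (blinfun_apply U ` K)"
      by (rule compact_continuous_image[OF _ K]) (intro continuous_intros)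
    have R: "0 \<le> l + norm (barycenter :: 'a lipfree \<Rightarrow>\<^sub>L 'a)"
      using assms(2) by simp
    obtain S d where S: "finite S" "S \<subseteq> range delta" and d: "0 < d"
      and small: "\<And>(L :: 'a lipfree \<Rightarrow>\<^sub>L 'a) \<mu>.
        norm L \<le> l + norm (barycenter :: 'a lipfree \<Rightarrow>\<^sub>L 'a) \<Longrightarrow>
        (\<And>s. s \<in> S \<Longrightarrow> norm (blinfun_apply L s) \<le> d) \<Longrightarrow> \<mu> \<in> blinfun_apply U ` K \<Longrightarrow>
        norm (blinfun_apply L \<mu>) < e"
      using uniformly_small_on_compact[OF closure_span_delta UK e R, where 'b='a] by blast
    obtain P where P: "finite P" "S = delta ` P"
      using finite_subset_image[OF S] by blast
    obtain f :: "('a, 'a) lip0" where f: "f \<in> lip_ideal_operators A" "norm f \<le> l"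
      and fP: "\<And>x. x \<in> P \<Longrightarrow> dist x (lip0_apply f x) < d"
    proof -
      have "\<exists>g\<in>lip0_apply ` {f \<in> lip_ideal_operators A. norm f \<le> l}.
          \<forall>x\<in>P. dist (id x) (g x :: 'a) < d"
        using assms(4) finite_imp_compact[OF P(1)] d
        unfolding lip_ideal_bap_def in_closure_of_compact_convergence by blast
      then show ?thesis using that by auto
    qed
    have Lf: "norm (linearization f) \<le> l"
      using norm_linearization_le[of f] f(2) by linarith
    have "norm ((linearization f - barycenter) (U x)) < e" if "x \<in> K" for x
    proof (rule small)
      show "norm (linearization f - barycenter) \<le> l + norm (barycenter :: 'a lipfree \<Rightarrow>\<^sub>L 'a)"
        using norm_triangle_ineq4[of "linearization f" barycenter] Lf by linarith
      show "norm ((linearization f - barycenter) s) \<le> d" if "s \<in> S" for s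
        using that fP P(2)
        by (auto simp: blinfun.bilinear_simps linearization_delta barycenter_delta dist_norm
            norm_minus_commute intro: less_imp_le)
    qed (use that in auto)
    then have "\<forall>x\<in>K. dist (id x) ((linearization f o\<^sub>L U) x) < e"
      by (simp add: blinfun.bilinear_simps bU dist_norm norm_minus_commute)
    moreover have "norm (linearization f o\<^sub>L U) \<le> l"
      using norm_blinfun_compose[of "linearization f" U] U(1) Lf by simp
    moreover have "linearization f o\<^sub>L U \<in> ideal_operators A"
    proof -
      have "linearization f \<in> ideal_operators A"
        using f(1) by (simp add: lip_ideal_operators_def)
      \<comment> \<open>An ideal operator into \<open>X\<close> comes with an embedding of \<open>X\<close>, the domain of \<open>U\<close>, into the
        universe.\<close>
      moreover from this obtain i :: "'a \<Rightarrow> 'u" where "inj i"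
        by (auto simp: ideal_operators_def)
      ultimately show ?thesis by (intro ideal_operators_compose)
    qed
    ultimately show "\<exists>g\<in>blinfun_apply ` {T \<in> ideal_operators A. norm T \<le> l}.
        \<forall>x\<in>K. dist (id x) (g x) < e"
      by blast
  qed
qed

end
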